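(* For all $L,h\in\mathbb{N}$ satisfying $0\le h\le L/2$, $$s(L,h)=s(L-h-1,h)+s(L-h,h)-s(L-2h-1,h)+s(h-1,L-2)+s(h-1,L-1).$$
   Context: $\mathbb{N}=\{0,1,2,\dots\}$. For a finite word $w$ over $\{0,1\}$, $|w|$ is its length and $|w|_0,|w|_1$ are its numbers of $0$'s and $1$'s; $|w|_1$ is the height of $w$. A subword means a contiguous factor. A word $w$ is balanced if for all finite subwords $u,v$ of $w$ with $|u|=|v|$ one has $\bigl||u|_0-|v|_0\bigr|\le 1$. For $0\le h\le L$, $\mathbb{S}(L,h)$ is the set of balanced words in $\{0,1\}^*$ of length $L$ and height $h$. The function $s:\mathbb{Z}^2\to\mathbb{N}$ is defined by $s(L,h)=\#\mathbb{S}(L,h\bmod L)$ if $L>0$ (with $h\bmod L\in\{0,\dots,L-1\}$), $s(0,0)=1$, and $s(L,h)=0$ if $L<0$ or if $L=0$ and $h\ne0$. *)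

theory Defs
  imports Main "HOL-Library.Sublist"
begin

text \<open>
  Words over the alphabet \<open>{0, 1}\<close> are Boolean lists: \<open>False\<close> is the letter \<open>0\<close> and \<open>True\<close> is
  the letter \<open>1\<close>. Subwords are contiguous factors, i.e. \<^const>\<open>sublist\<close>
  (and not the scattered \<^const>\<open>subseq\<close>).
\<close>

type_synonym word01 = "bool list"

definition height :: "word01 \<Rightarrow> nat" where
  "height w = count_list w True"

definition balanced :: "word01 \<Rightarrow> bool" where
  "balanced w \<longleftrightarrow>
     (\<forall>u v. sublist u w \<longrightarrow> sublist v w \<longrightarrow> length u = length v \<longrightarrow>
        \<bar>int (count_list u False) - int (count_list v False)\<bar> \<le> 1)"

definition balanced_words :: "nat \<Rightarrow> nat \<Rightarrow> word01 set" where
  "balanced_words L h = {w. balanced w \<and> length w = L \<and> height w = h}"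

definition s :: "int \<Rightarrow> int \<Rightarrow> nat" where
  "s L h =
     (if L > 0 then card (balanced_words (nat L) (nat (h mod L)))
      else if L = 0 \<and> h = 0 then 1
      else 0)"

end

theory Submission
  imports Defs
begin

text \<open>
  A word ending in \<open>1\<close> is \<open>0 \<dots> 0 1 0 \<dots> 0 1 \<dots>\<close>, and it is balanced iff the sum of any window of its gap list \<open>a\<close>
  exceeds the sum of any window of the same length that is not a prefix by at most one. This condition is
  invariant under adding a constant to all gaps. Write \<open>n\<^sub>c\<^sub>d(L, h)\<close> for the number of balanced words of
  length \<open>L\<close> and height \<open>h\<close> from \<open>c\<close> to \<open>d\<close>.

  If the first letter is \<open>1\<close> as well, the remaining \<open>h - 1\<close> gaps take two consecutive values, and
  reducing them to \<open>0\<close> and \<open>1\<close> gives \<open>n\<^sub>1\<^sub>1(L, h) = s(h - 1, L - 1)\<close>; exchanging the letters,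
  \<open>n\<^sub>0\<^sub>0(L, h) = s(L - h - 1, h)\<close>. If the first letter is \<open>0\<close> and \<open>2 h \<le> L\<close>, all gaps are positive, and
  decreasing each by one gives \<open>n\<^sub>0\<^sub>1(L, h) = n\<^sub>0\<^sub>1(L - h, h) + n\<^sub>1\<^sub>1(L - h, h)\<close>. The recurrence follows by
  eliminating \<open>n\<^sub>0\<^sub>1\<close> from \<open>s = n\<^sub>0\<^sub>0 + 2 n\<^sub>0\<^sub>1 + n\<^sub>1\<^sub>1\<close> at lengths \<open>L\<close> and \<open>L - h\<close>.
\<close>

section \<open>Partial sums and the steadiness condition\<close>

definition ones :: "word01 \<Rightarrow> nat \<Rightarrow> nat" where
  "ones w i = count_list (take i w) True"

definition gsum :: "nat list \<Rightarrow> nat \<Rightarrow> nat" where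
  "gsum a i = sum_list (take i a)"

text \<open>
  \<open>S\<close> is a sequence of partial sums and \<open>p\<close> is the least start of the windows on the right-hand side:
  \<open>0\<close> for words, \<open>1\<close> for gap lists, whose first gap may be cut off by the start of the word.
\<close>

definition steady :: "nat \<Rightarrow> nat \<Rightarrow> (nat \<Rightarrow> nat) \<Rightarrow> bool" where
  "steady p n S \<longleftrightarrow>
     (\<forall>i j l. i + l \<le> n \<longrightarrow> p \<le> j \<longrightarrow> j + l \<le> n \<longrightarrow> S (i + l) + S j \<le> S (j + l) + S i + 1)"

lemma steadyD:
  "steady p n S \<Longrightarrow> i + l \<le> n \<Longrightarrow> p \<le> j \<Longrightarrow> j + l \<le> n \<Longrightarrow> S (i + l) + S j \<le> S (j + l) + S i + 1"
  unfolding steady_def by blast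

lemma steady_cong:
  assumes "\<And>i. i \<le> n \<Longrightarrow> S i = T i"
  shows "steady p n S = steady p n T"
  unfolding steady_def using assms by (auto simp: add_leD1)

text \<open>Both compared windows have length \<open>l\<close>, so each gains the same amount
  \<open>k * l\<close>.\<close>

lemma steady_add_linear: "steady p n (\<lambda>i. k * i + S i) = steady p n S"
  unfolding steady_def by (simp add: algebra_simps)

section \<open>Balance as steadiness of the prefix counts of 1\<close>

lemma count_list_False: "count_list w False = length w - count_list w True"
  and count_list_le: "count_list w True \<le> length w"
proof -
  have "count_list w False + count_list w True = length w"
    by (induction w) auto
  then show "count_list w False = length w - count_list w True" "count_list w True \<le> length w"
    by auto
qed

lemma ones_0 [simp]: "ones w 0 = 0"
  by (simp add: ones_def)

lemma ones_length: "ones w (length w) = height w"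
  by (simp add: ones_def height_def)

lemma ones_add: "ones w (i + l) = ones w i + count_list (take l (drop i w)) True"
  by (simp add: ones_def take_add)

lemma ones_le: "ones w i \<le> i"
  unfolding ones_def using count_list_le[of "take i w"] by simp

lemma ones_le_height: "ones w i \<le> height w"
  unfolding ones_def height_def
  by (metis append_take_drop_id count_list_append le_add1)

lemma sublist_iff_take_drop: "sublist u w \<longleftrightarrow> (\<exists>i. i + length u \<le> length w \<and> u = take (length u) (drop i w))"
proof
  assume "sublist u w"
  then obtain p q where "w = p @ u @ q" by (auto simp: sublist_def)
  then show "\<exists>i. i + length u \<le> length w \<and> u = take (length u) (drop i w)"
    by (intro exI[of _ "length p"]) auto
next
  assume "\<exists>i. i + length u \<le> length w \<and> u = take (length u) (drop i w)"
  then show "sublist u w"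
    by (metis append_take_drop_id sublist_def)
qed

text \<open>In factors of equal length the counts of 0 and of 1 differ by the same amount. With
  \<open>p = 0\<close> the starts \<open>i\<close> and \<open>j\<close> can be swapped, so the
  one-sided bound yields the absolute value.\<close>

lemma balanced_iff_steady: "balanced w \<longleftrightarrow> steady 0 (length w) (ones w)"
proof
  assume b: "balanced w"
  show "steady 0 (length w) (ones w)"
    unfolding steady_def
  proof (intro allI impI)
    fix i j l assume ij: "i + l \<le> length w" "j + l \<le> length w"
    let ?u = "take l (drop i w)" and ?v = "take l (drop j w)"
    have len: "length ?u = l" "length ?v = l" using ij by auto
    then have "sublist ?u w" "sublist ?v w"
      using ij by (metis sublist_iff_take_drop)+
    with b len have "\<bar>int (count_list ?u False) - int (count_list ?v False)\<bar> \<le> 1"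
      unfolding balanced_def by metis
    then show "ones w (i + l) + ones w j \<le> ones w (j + l) + ones w i + 1"
      using len count_list_le[of ?u] count_list_le[of ?v] unfolding ones_add count_list_False by linarith
  qed
next
  assume st: "steady 0 (length w) (ones w)"
  show "balanced w"
    unfolding balanced_def
  proof (intro allI impI)
    fix u v assume uv: "sublist u w" "sublist v w" "length u = length v"
    obtain i where i: "i + length u \<le> length w" "u = take (length u) (drop i w)"
      using uv(1) sublist_iff_take_drop by blast
    obtain j where j: "j + length u \<le> length w" "v = take (length u) (drop j w)"
      using uv(2,3) sublist_iff_take_drop by metis
    have "ones w (i + length u) + ones w j \<le> ones w (j + length u) + ones w i + 1"
         "ones w (j + length u) + ones w i \<le> ones w (i + length u) + ones w j + 1"
      by (rule steadyD[OF st]; use i(1) j(1) in simp)+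
    then show "\<bar>int (count_list u False) - int (count_list v False)\<bar> \<le> 1"
      using count_list_le[of u] count_list_le[of v] uv(3)
      unfolding ones_add count_list_False i(2)[symmetric] j(2)[symmetric] by linarith
  qed
qed

lemma balanced_rev: "balanced (rev w) = balanced w"
proof -
  have *: "balanced w \<Longrightarrow> balanced (rev w)" for w
    unfolding balanced_def
    by (metis sublist_rev rev_rev_ident length_rev count_list_rev)
  show ?thesis using *[of w] *[of "rev w"] by auto
qed

lemma ones_map_Not: "i \<le> length w \<Longrightarrow> ones (map Not w) i = i - ones w i"
proof -
  have "count_list (map Not v) True = count_list v False" for v by (induction v) auto
  then show "i \<le> length w \<Longrightarrow> ones (map Not w) i = i - ones w i"
    by (simp add: ones_def take_map count_list_False)
qed

lemma balanced_map_Not: "balanced (map Not w) = balanced w"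
proof -
  have *: "balanced (map Not w)" if "balanced w" for w
    unfolding balanced_iff_steady steady_def
  proof (intro allI impI)
    fix i j l assume "i + l \<le> length (map Not w)" "j + l \<le> length (map Not w)"
    then have ij: "i + l \<le> length w" "j + l \<le> length w" by auto
    have "ones w (j + l) + ones w i \<le> ones w (i + l) + ones w j + 1"
      using ij that unfolding balanced_iff_steady by (intro steadyD) auto
    then show "ones (map Not w) (i + l) + ones (map Not w) j
        \<le> ones (map Not w) (j + l) + ones (map Not w) i + 1"
      using ij ones_le[of w i] ones_le[of w j] ones_le[of w "i + l"] ones_le[of w "j + l"]
      by (simp add: ones_map_Not)
  qed
  show ?thesis using *[of w] *[of "map Not w"] by (auto simp: comp_def)
qed

section \<open>Encoding of words ending in 1 by gap lists\<close>

fun enc :: "nat list \<Rightarrow> word01" where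
  "enc [] = []"
| "enc (x # a) = replicate x False @ True # enc a"

lemma length_enc: "length (enc a) = sum_list a + length a"
  by (induction a) auto

lemma height_enc: "height (enc a) = length a"
  by (induction a) (auto simp: height_def count_list_0_iff)

lemma hd_enc: "hd (enc (x # a)) \<longleftrightarrow> x = 0"
  by (cases x) auto

lemma enc_eq_Nil [simp]: "enc a = [] \<longleftrightarrow> a = []"
  by (cases a) auto

lemma last_enc: "a \<noteq> [] \<Longrightarrow> last (enc a)"
  by (induction a) auto

lemma replicate_False_True_eq:
  "replicate x False @ True # u = replicate y False @ True # v \<longleftrightarrow> x = y \<and> u = v"
proof (induction x arbitrary: y)
  case 0 then show ?case by (cases y) auto
next
  case (Suc x) then show ?case by (cases y) auto
qed

lemma enc_inj: "inj enc"
proof (rule injI)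
  fix a b show "enc a = enc b \<Longrightarrow> a = b"
  proof (induction a arbitrary: b)
    case Nil then show ?case by (cases b) auto
  next
    case (Cons x a) then show ?case by (cases b) (auto simp: replicate_False_True_eq)
  qed
qed

lemma enc_surj:
  assumes "w \<noteq> []" "last w"
  shows "\<exists>a. a \<noteq> [] \<and> w = enc a"
  using assms
proof (induction w)
  case (Cons c w)
  show ?case
  proof (cases "w = []")
    case True
    with Cons.prems show ?thesis by (intro exI[of _ "[0]"]) auto
  next
    case False
    with Cons obtain x a where "w = enc (x # a)" by (auto simp: neq_Nil_conv)
    then show ?thesis
      \<comment> \<open>Prepending 1 opens a new gap 0; prepending 0 lengthens the first
        gap.\<close>
      by (intro exI[of _ "if c then 0 # x # a else Suc x # a"]) auto
  qed
qed simp

lemma gsum_Cons [simp]: "gsum (x # a) (Suc i) = x + gsum a i" "gsum a 0 = 0"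
  by (auto simp: gsum_def)

text \<open>The \<open>i\<close>-th letter \<open>1\<close> of \<open>enc a\<close> is its letter number \<open>i + gsum a i\<close>, counting from one.\<close>

lemma le_ones_enc_iff: "i \<le> length a \<Longrightarrow> i \<le> ones (enc a) t \<longleftrightarrow> i + gsum a i \<le> t"
proof (induction a arbitrary: i t)
  case (Cons x a)
  show ?case
  proof (cases i)
    case (Suc k)
    show ?thesis
    proof (cases "t \<le> x")
      case True
      then show ?thesis using Suc by (simp add: ones_def count_list_0_iff)
    next
      case False
      then obtain d where d: "t = x + Suc d"
        by (metis add_Suc_right less_imp_Suc_add not_le)
      have "ones (enc (x # a)) t = Suc (ones (enc a) d)"
        unfolding d by (simp add: ones_def take_Cons' count_list_0_iff)
      then show ?thesis using Cons Suc d by simp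
    qed
  qed simp
qed simp

section \<open>Balance in terms of gaps\<close>

lemma gsum_mono: "i \<le> j \<Longrightarrow> gsum a i \<le> gsum a j"
  unfolding gsum_def by (metis le_add1 le_Suc_ex sum_list_append take_add)

lemma gsum_length: "gsum a (length a) = sum_list a"
  by (simp add: gsum_def)

text \<open>Factors rich in 1 are tightest when they start and end with a 1, and poor ones are
  widest just between two 1s. Comparing these extremes turns an excess of two in the count of 1 into
  an excess of two in gap sums. The rich factor starts at the \<open>j\<close>-th 1, hence
  \<open>1 <= j\<close>; the poor one may start with the word, hence \<open>i = 0\<close> is
  allowed.\<close>

lemma balanced_enc_iff: "balanced (enc a) \<longleftrightarrow> steady 1 (length a) (gsum a)"
proof
  let ?N = "ones (enc a)" and ?P = "\<lambda>i. i + gsum a i"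
  assume "balanced (enc a)"
  then have st: "steady 0 (length (enc a)) ?N" by (simp add: balanced_iff_steady)
  show "steady 1 (length a) (gsum a)"
    unfolding steady_def
  proof (intro allI impI, rule ccontr)
    fix i j l assume ij: "i + l \<le> length a" "1 \<le> j" "j + l \<le> length a"
      and "\<not> gsum a (i + l) + gsum a j \<le> gsum a (j + l) + gsum a i + 1"
    then have gt: "?P (i + l) + ?P j \<ge> ?P (j + l) + ?P i + 2" by simp
    then have l: "l \<noteq> 0" by (cases l) auto
    \<comment> \<open>The length of the factor from the \<open>j\<close>-th to the
      \<open>(j + l)\<close>-th 1. It contains \<open>l + 1\<close> ones, while the \<open>d\<close>
      letters after position \<open>?P i\<close> stop before the \<open>(i + l)\<close>-th 1 and
      contain at most \<open>l - 1\<close>.\<close>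
    define d where "d = ?P (j + l) - ?P j + 1"
    have Pj: "?P j + d = ?P (j + l) + 1" "?P j \<ge> 1"
      using gsum_mono[of j "j + l" a] ij unfolding d_def by auto
    have Pi: "?P i + d < ?P (i + l)" using gt Pj by simp
    have "?P (i + l) \<le> length (enc a)" "?P (j + l) \<le> length (enc a)"
      using ij gsum_mono[of "i + l" "length a" a] gsum_mono[of "j + l" "length a" a]
      by (simp_all add: length_enc gsum_length)
    then have "?N (?P j - 1 + d) + ?N (?P i) \<le> ?N (?P i + d) + ?N (?P j - 1) + 1"
      using Pi Pj by (intro steadyD[OF st]) auto
    moreover have "j + l \<le> ?N (?P j - 1 + d)"
      using le_ones_enc_iff[of "j + l" a "?P j - 1 + d"] ij(3) Pj by linarith
    moreover have "\<not> j \<le> ?N (?P j - 1)"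
      using le_ones_enc_iff[of j a "?P j - 1"] ij by simp
    moreover have "i \<le> ?N (?P i)"
      using le_ones_enc_iff[of i a "?P i"] ij by simp
    moreover have "\<not> i + l \<le> ?N (?P i + d)"
      using le_ones_enc_iff[of "i + l" a "?P i + d"] ij Pi by simp
    ultimately show False by linarith
  qed
next
  let ?N = "ones (enc a)" and ?P = "\<lambda>i. i + gsum a i"
  assume st: "steady 1 (length a) (gsum a)"
  show "balanced (enc a)"
    unfolding balanced_iff_steady steady_def
  proof (intro allI impI, rule ccontr)
    fix t t' l assume t: "t + l \<le> length (enc a)" "t' + l \<le> length (enc a)"
      and gt: "\<not> ?N (t + l) + ?N t' \<le> ?N (t' + l) + ?N t + 1"
    have N: "?N x \<le> length a" for x using ones_le_height[of "enc a" x] by (simp add: height_enc)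
    define i where "i = ?N t'"
    define j where "j = Suc (?N t)"
    define c where "c = ?N (t' + l) - ?N t'"
    have c: "?N (t' + l) = i + c" unfolding c_def i_def by (simp add: ones_add)
    have jc: "j + Suc c \<le> ?N (t + l)" using gt c unfolding j_def i_def by simp
    then have jc': "j + Suc c \<le> length a" using N[of "t + l"] by simp
    have Pj: "t < ?P j" using le_ones_enc_iff[of j a t] jc' by (simp add: j_def)
    have Pjc: "?P (j + Suc c) \<le> t + l" using le_ones_enc_iff[of "j + Suc c" a "t + l"] jc jc' by simp
    have Pi: "?P i \<le> t'" using le_ones_enc_iff[of i a t'] N[of t'] by (simp add: i_def)
    show False
    proof (cases "i + Suc c \<le> length a")
      case True
      have "t' + l < ?P (i + Suc c)"
        using le_ones_enc_iff[OF True, of "t' + l"] c by simp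
      moreover have "gsum a (i + Suc c) + gsum a j \<le> gsum a (j + Suc c) + gsum a i + 1"
        using True jc' by (intro steadyD[OF st]) (auto simp: j_def)
      ultimately show False using Pj Pjc Pi by linarith
    next
      case False
      \<comment> \<open>No 1 follows the poor factor. Since \<open>enc a\<close> ends in 1, position
        \<open>?P (i + c)\<close> is the end of the word, so comparing \<open>c\<close> gaps instead
        of \<open>Suc c\<close> suffices.\<close>
      then have ic: "i + c = length a" using N[of "t' + l"] c by simp
      then have "?P (i + c) \<ge> t' + l"
        using t by (simp add: gsum_length length_enc)
      moreover have "gsum a (i + c) + gsum a j \<le> gsum a (j + c) + gsum a i + 1"
        using ic jc' by (intro steadyD[OF st]) (auto simp: j_def)
      moreover have "gsum a (j + c) \<le> gsum a (j + Suc c)" by (rule gsum_mono) simp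
      ultimately show False using Pj Pjc Pi by linarith
    qed
  qed
qed

section \<open>Balanced words by first and last letter\<close>

text \<open>For \<open>0 < h\<close> these encode the balanced words ending in 1 that have
  \<open>N\<close> zeros and \<open>h\<close> ones.\<close>

definition gap_lists :: "nat \<Rightarrow> nat \<Rightarrow> nat list set" where
  "gap_lists N h = {a. length a = h \<and> sum_list a = N \<and> steady 1 h (gsum a)}"

definition bwords :: "bool \<Rightarrow> bool \<Rightarrow> nat \<Rightarrow> nat \<Rightarrow> word01 set" where
  "bwords c d L h = {w \<in> balanced_words L h. w \<noteq> [] \<and> hd w = c \<and> last w = d}"

lemma finite_balanced_words [simp]: "finite (balanced_words L h)"
proof -
  have "balanced_words L h \<subseteq> {w. set w \<subseteq> UNIV \<and> length w = L}"
    by (auto simp: balanced_words_def)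
  then show ?thesis using finite_lists_length_eq[of "UNIV :: bool set" L] finite_subset by auto
qed

lemma finite_bwords [simp]: "finite (bwords c d L h)"
  by (simp add: bwords_def)

lemma bwords_True_eq:
  assumes "0 < h" "h \<le> L"
  shows "bwords c True L h = enc ` {a \<in> gap_lists (L - h) h. c \<longleftrightarrow> hd a = 0}" (is "?A = ?B")
proof
  show "?A \<subseteq> ?B"
  proof
    fix w assume w: "w \<in> ?A"
    then obtain a where a: "a \<noteq> []" "w = enc a" using enc_surj by (auto simp: bwords_def)
    moreover have "c \<longleftrightarrow> hd a = 0" using w a hd_enc[of "hd a" "tl a"] by (simp add: bwords_def)
    ultimately show "w \<in> ?B" using w 
      by (auto simp: bwords_def gap_lists_def balanced_words_def length_enc height_enc balanced_enc_iff)
  qed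
  show "?B \<subseteq> ?A"
  proof
    fix w assume "w \<in> ?B"
    then obtain a where a: "w = enc a" "a \<in> gap_lists (L - h) h" "c \<longleftrightarrow> hd a = 0" by auto
    then have "a \<noteq> []" using assms by (auto simp: gap_lists_def)
    then show "w \<in> ?A" using a assms last_enc[of a] hd_enc[of "hd a" "tl a"]
      by (auto simp: bwords_def gap_lists_def balanced_words_def length_enc height_enc balanced_enc_iff)
  qed
qed

lemma card_bwords_True:
  assumes "0 < h" "h \<le> L"
  shows "card (bwords c True L h) = card {a \<in> gap_lists (L - h) h. c \<longleftrightarrow> hd a = 0}"
  unfolding bwords_True_eq[OF assms] by (rule card_image) (meson enc_inj inj_on_subset subset_UNIV)

section \<open>Words from 0 to 1: decreasing every gap by one\<close>

lemma gsum_map_add: "i \<le> length b \<Longrightarrow> gsum (map (\<lambda>x. k + f x) b) i = k * i + gsum (map f b) i"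
  unfolding gsum_def by (simp add: take_map sum_list_addf sum_list_triv)

text \<open>A zero gap other than the first bounds every gap by 1, by comparing windows of length
  one. The gaps then sum to less than \<open>h\<close>, as one of them is 0.\<close>

lemma gap_sum_pos:
  assumes a: "a \<in> gap_lists N h" and N: "h \<le> N" and hd: "hd a \<noteq> 0" and x: "x \<in> set a"
  shows "x \<noteq> 0"
proof
  assume "x = 0"
  have len: "length a = h" "sum_list a = N" and st: "steady 1 h (gsum a)" using a by (auto simp: gap_lists_def)
  have gs: "gsum a (i + 1) = gsum a i + a ! i" if "i < h" for i
    using that len by (simp add: gsum_def take_Suc_conv_app_nth)
  obtain j where j: "j < h" "a ! j = 0" using x len \<open>x = 0\<close> by (auto simp: in_set_conv_nth)
  have "j \<noteq> 0" using hd j len by (metis hd_conv_nth length_0_conv not_less0)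
  have le: "a ! i \<le> 1" if "i < h" for i
  proof -
    have "gsum a (i + 1) + gsum a j \<le> gsum a (j + 1) + gsum a i + 1"
      using that j \<open>j \<noteq> 0\<close> by (intro steadyD[OF st]) auto
    then show ?thesis using gs[OF that] gs[OF j(1)] j by simp
  qed
  have "sum_list a = (\<Sum>i<h. a ! i)" using len by (simp add: sum_list_sum_nth atLeast0LessThan)
  also have "\<dots> < (\<Sum>i<h. 1)" using le j by (intro sum_strict_mono_ex1) auto
  finally show False using N len by simp
qed

lemma card_gap_lists_hd_pos:
  assumes "0 < h"
  shows "card {a \<in> gap_lists (N + h) h. hd a \<noteq> 0} = card (gap_lists N h)"
proof -
  have st: "steady 1 (length a) (gsum (map Suc a)) = steady 1 (length a) (gsum a)" for a
  proof -
    have "steady 1 (length a) (gsum (map Suc a)) = steady 1 (length a) (\<lambda>i. 1 * i + gsum a i)"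
      using gsum_map_add[of _ a 1 id] by (intro steady_cong) auto
    then show ?thesis by (simp only: steady_add_linear)
  qed
  have sl: "sum_list (map Suc a) = sum_list a + length a" for a by (induction a) auto
  have "{a \<in> gap_lists (N + h) h. hd a \<noteq> 0} = map Suc ` gap_lists N h"
  proof (intro equalityI subsetI)
    fix a assume "a \<in> {a \<in> gap_lists (N + h) h. hd a \<noteq> 0}"
    then have a: "a \<in> gap_lists (N + h) h" "hd a \<noteq> 0" by auto
    define b where "b = map (\<lambda>x. x - 1) a"
    have "a = map Suc b"
      unfolding b_def using gap_sum_pos[OF a(1) _ a(2)] by (auto simp: map_idI comp_def)
    then show "a \<in> map Suc ` gap_lists N h"
      using a st[of b] sl[of b] by (auto simp: gap_lists_def)
  next
    fix a assume "a \<in> map Suc ` gap_lists N h"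
    then obtain b where b: "a = map Suc b" "b \<in> gap_lists N h" by auto
    then show "a \<in> {a \<in> gap_lists (N + h) h. hd a \<noteq> 0}"
      using assms st[of b] sl[of b] by (cases b) (auto simp: gap_lists_def)
  qed
  then show ?thesis by (simp only: card_image[OF inj_on_subset[OF inj_mapI[OF inj_Suc] subset_UNIV]])
qed

lemma bwords_height_0: "bwords c True L 0 = {}"
proof -
  have "\<not> last w" if "height w = 0" "w \<noteq> []" for w
    using that last_in_set[of w] by (metis (full_types) height_def count_list_0_iff)
  then show ?thesis by (auto simp: bwords_def balanced_words_def)
qed

lemma card_bwords_False_True:
  assumes "2 * h \<le> L"
  shows "card (bwords False True L h)
    = card (bwords False True (L - h) h) + card (bwords True True (L - h) h)"
proof (cases "h = 0")
  case True
  then show ?thesis by (simp add: bwords_height_0)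
next
  case False
  let ?G = "gap_lists (L - h - h) h"
  \<comment> \<open>After the decrease the first gap may or may not be 0, so both first letters
    occur.\<close>
  have "bwords False True (L - h) h \<union> bwords True True (L - h) h = enc ` ?G"
    using False assms by (subst (1 2) bwords_True_eq) auto
  moreover have "bwords False True (L - h) h \<inter> bwords True True (L - h) h = {}"
    by (auto simp: bwords_def)
  ultimately have "card (bwords False True (L - h) h) + card (bwords True True (L - h) h) = card (enc ` ?G)"
    by (metis card_Un_disjoint finite_bwords)
  also have "\<dots> = card ?G" by (rule card_image) (meson enc_inj inj_on_subset subset_UNIV)
  also have "\<dots> = card {a \<in> gap_lists (L - h - h + h) h. hd a \<noteq> 0}"
    using False by (intro card_gap_lists_hd_pos[symmetric]) simp
  also have "\<dots> = card (bwords False True L h)"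
    using False assms by (subst card_bwords_True) auto
  finally show ?thesis by simp
qed

section \<open>Words from 1 to 1: reducing the gaps to 0 and 1\<close>

text \<open>A window starting at the leading 0 has the sum of a window of \<open>a\<close> that is
  one shorter, so it adds no constraint; all others are windows of \<open>a\<close>.\<close>

lemma steady_Cons_0:
  "steady 1 (Suc m) (gsum (0 # a)) \<longleftrightarrow> steady 0 m (gsum a)"
proof
  assume st: "steady 1 (Suc m) (gsum (0 # a))"
  show "steady 0 m (gsum a)"
    unfolding steady_def
  proof (intro allI impI)
    fix i j l assume "i + l \<le> m" "j + l \<le> m"
    then show "gsum a (i + l) + gsum a j \<le> gsum a (j + l) + gsum a i + 1"
      using steadyD[OF st, of "Suc i" l "Suc j"] by simp
  qed
next
  assume st: "steady 0 m (gsum a)"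
  show "steady 1 (Suc m) (gsum (0 # a))"
    unfolding steady_def
  proof (intro allI impI)
    fix i j l assume ij: "i + l \<le> Suc m" "1 \<le> j" "j + l \<le> Suc m"
    then obtain j' where j': "j = Suc j'" by (cases j) auto
    show "gsum (0 # a) (i + l) + gsum (0 # a) j \<le> gsum (0 # a) (j + l) + gsum (0 # a) i + 1"
    proof (cases i)
      case (Suc i')
      then show ?thesis using ij j' steadyD[OF st, of i' l j'] by simp
    next
      case 0
      show ?thesis
      proof (cases l)
        case (Suc l')
        then show ?thesis using 0 ij j' steadyD[OF st, of 0 l' j'] gsum_mono[of "j' + l'" "j' + l" a]
          by simp
      qed (use 0 in simp)
    qed
  qed
qed

lemma gsum_of_bool: "gsum (map of_bool b) i = ones b i"
proof -
  have "sum_list (map of_bool v) = count_list v True" for v :: "bool list" by (induction v) auto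
  then show ?thesis by (simp add: gsum_def ones_def take_map)
qed

lemma sum_list_map_add_of_bool:
  "sum_list (map (\<lambda>x. k + of_bool x) b) = k * length b + height b"
  by (induction b) (auto simp: height_def)

lemma steady_map_add_of_bool:
  "steady 0 (length b) (gsum (map (\<lambda>x. k + of_bool x) b)) \<longleftrightarrow> balanced b"
proof -
  have "steady 0 (length b) (gsum (map (\<lambda>x. k + of_bool x) b))
      = steady 0 (length b) (\<lambda>i. k * i + ones b i)"
    by (intro steady_cong) (simp add: gsum_map_add gsum_of_bool)
  then show ?thesis by (simp add: steady_add_linear balanced_iff_steady)
qed

text \<open>Windows of length one show that every entry is the minimum \<open>g\<close> or
  \<open>g + 1\<close>. The minimum occurs, so fewer than \<open>m\<close> entries are
  \<open>g + 1\<close>; thus \<open>g\<close> and their number are the quotient and remainder of the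
  sum by \<open>m\<close>.\<close>

lemma steady_gaps_two_values:
  assumes "0 < m" "length a = m" and st: "steady 0 m (gsum a)"
  shows "\<exists>b. length b = m \<and> height b = sum_list a mod m
           \<and> a = map (\<lambda>x. sum_list a div m + of_bool x) b"
proof -
  define g where "g = Min (set a)"
  have "set a \<noteq> {}" using assms by auto
  then have g: "g \<in> set a" unfolding g_def by (intro Min_in) auto
  then obtain j where j: "j < m" "a ! j = g" using assms by (auto simp: in_set_conv_nth)
  have gs: "gsum a (i + 1) = gsum a i + a ! i" if "i < m" for i
    using that assms by (simp add: gsum_def take_Suc_conv_app_nth)
  have two: "x = g + of_bool (x \<noteq> g)" if x: "x \<in> set a" for x
  proof -
    obtain i where i: "i < m" "a ! i = x" using x assms(2) by (auto simp: in_set_conv_nth)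
    have "x \<le> g + 1" using steadyD[OF st, of i 1 j] gs i j by simp
    moreover have "g \<le> x" using that by (simp add: g_def)
    ultimately show ?thesis by auto
  qed
  define b where "b = map (\<lambda>x. x \<noteq> g) a"
  have len: "length b = m" using assms by (simp add: b_def)
  have a: "a = map (\<lambda>x. g + of_bool x) b"
    unfolding b_def map_map by (rule map_idI[symmetric]) (simp add: two[symmetric])
  have "False \<in> set b" using g by (auto simp: b_def)
  then have "height b < m"
    using len count_list_False[of b] count_list_le[of b] count_list_0_iff[of b False]
    by (simp add: height_def)
  moreover have "sum_list a = g * m + height b"
    using sum_list_map_add_of_bool[of g b] len a by simp
  ultimately have "sum_list a div m = g" "sum_list a mod m = height b"
    by simp_all
  then show ?thesis using a len by (intro exI[of _ b]) auto
qed

lemma card_steady_lists: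
  assumes "0 < m"
  shows "card {a. length a = m \<and> sum_list a = N \<and> steady 0 m (gsum a)}
    = card (balanced_words m (N mod m))" (is "card ?A = card ?B")
proof -
  let ?f = "map (\<lambda>x. N div m + of_bool x) :: bool list \<Rightarrow> nat list"
  have "?A = ?f ` ?B"
  proof (intro equalityI subsetI)
    fix a assume a: "a \<in> ?A"
    then obtain b where b: "length b = m" "height b = N mod m" "a = ?f b"
      using steady_gaps_two_values[OF assms, of a] by auto
    then have "b \<in> ?B"
      using a steady_map_add_of_bool[of b "N div m"] by (simp add: balanced_words_def)
    then show "a \<in> ?f ` ?B" using b(3) by blast
  next
    fix a assume "a \<in> ?f ` ?B"
    then obtain b where b: "b \<in> ?B" "a = ?f b" by blast
    then show "a \<in> ?A"
      using steady_map_add_of_bool[of b "N div m"]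
      by (auto simp: balanced_words_def sum_list_map_add_of_bool)
  qed
  moreover have "inj_on ?f ?B"
    by (rule inj_on_subset[OF inj_mapI subset_UNIV]) (auto simp: inj_def of_bool_def split: if_splits)
  ultimately show ?thesis by (simp add: card_image)
qed

lemma s_nat: "0 < L \<Longrightarrow> s (int L) (int h) = card (balanced_words L (h mod L))"
  by (simp add: s_def nat_mod_distrib)

text \<open>The first gap is 0 and the other \<open>h - 1\<close> are counted by
  \<open>card_steady_lists\<close>. For \<open>h <= 1\<close> none or only the empty list remains,
  and the values of \<open>s\<close> at first argument -1 and 0 fit.\<close>

lemma card_bwords_True_True:
  assumes "h \<le> L"
  shows "card (bwords True True L h) = s (int h - 1) (int L - 1)"
proof -
  consider "h = 0" | "h = 1" | m where "h = Suc m" "0 < m"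
    by (metis One_nat_def gr0I not0_implies_Suc)
  then show ?thesis
  proof cases
    case 1
    then show ?thesis by (simp add: s_def bwords_height_0)
  next
    case 2
    have "card (bwords True True L h) = card {a \<in> gap_lists (L - 1) 1. hd a = 0}"
      using 2 assms by (subst card_bwords_True) auto
    also have "{a \<in> gap_lists (L - 1) 1. hd a = 0} = (if L = 1 then {[0]} else {})"
      using 2 assms steady_Cons_0[of 0 "[]"] by (auto simp: gap_lists_def length_Suc_conv steady_def[of 0])
    finally show ?thesis using 2 assms by (auto simp: s_def)
  next
    case (3 m)
    have "{a \<in> gap_lists (L - h) h. hd a = 0}
        = (#) 0 ` {a. length a = m \<and> sum_list a = L - h \<and> steady 0 m (gsum a)}"
      using 3 by (auto simp: gap_lists_def length_Suc_conv steady_Cons_0[symmetric])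
    then have "card (bwords True True L h)
        = card {a. length a = m \<and> sum_list a = L - h \<and> steady 0 m (gsum a)}"
      using 3 assms by (subst card_bwords_True) (auto simp: card_image)
    also have "\<dots> = card (balanced_words m ((L - h) mod m))"
      using 3 by (simp add: card_steady_lists)
    \<comment> \<open>\<open>L - h\<close> is \<open>(L - 1) - m\<close>.\<close>
    also have "(L - h) mod m = (L - 1) mod m"
      using 3 assms by (simp add: le_mod_geq)
    also have "card (balanced_words m ((L - 1) mod m)) = s (int h - 1) (int L - 1)"
      using 3 assms s_nat[of m "L - 1"] by simp
    finally show ?thesis .
  qed
qed

section \<open>Symmetries: reversal and exchange of letters\<close>

lemma bwords_rev: "bwords c d L h = rev ` bwords d c L h"
proof -
  have *: "rev w \<in> bwords c d L h \<longleftrightarrow> w \<in> bwords d c L h" for w c d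
    by (auto simp: bwords_def balanced_words_def balanced_rev height_def hd_rev last_rev)
  show ?thesis using *[of _ c d] by (auto simp: image_iff) (metis rev_rev_ident)
qed

lemma card_bwords_rev: "card (bwords c d L h) = card (bwords d c L h)"
  by (subst bwords_rev) (simp add: card_image)

lemma height_map_Not: "height (map Not w) = length w - height w"
  using ones_map_Not[of "length w" w] ones_length[of "map Not w"] by (simp add: ones_length)

lemma height_le: "height w \<le> length w"
  by (simp add: height_def count_list_le)

lemma card_bwords_complement:
  assumes "h \<le> L"
  shows "card (bwords (\<not> c) (\<not> d) L (L - h)) = card (bwords c d L h)"
proof -
  have *: "map Not w \<in> bwords (\<not> c) (\<not> d) L (L - h) \<longleftrightarrow> w \<in> bwords c d L h" for w
    using assms height_le[of w]
    by (auto simp: bwords_def balanced_words_def balanced_map_Not height_map_Not hd_map last_map)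
  have "bwords (\<not> c) (\<not> d) L (L - h) = map Not ` bwords c d L h"
  proof (intro equalityI subsetI)
    fix w assume "w \<in> bwords (\<not> c) (\<not> d) L (L - h)"
    then show "w \<in> map Not ` bwords c d L h"
      using *[of "map Not w"] by (intro image_eqI[of _ _ "map Not w"]) (auto simp: comp_def)
  qed (use * in auto)
  moreover have "inj (map Not)" by (auto intro!: inj_mapI simp: inj_def)
  ultimately show ?thesis by (metis card_image inj_on_subset subset_UNIV)
qed

lemma s_mod_eq: "0 < L \<Longrightarrow> h mod L = h' mod L \<Longrightarrow> s L h = s L h'"
  by (simp add: s_def)

lemma card_bwords_False_False:
  assumes "h \<le> L"
  shows "card (bwords False False L h) = s (int L - int h - 1) (int h)"
proof -
  let ?m = "int L - int h - 1"
  have "card (bwords False False L h) = card (bwords True True L (L - h))"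
    using card_bwords_complement[OF assms, of False False] by simp
  also have "\<dots> = s ?m (int L - 1)"
    using assms by (simp add: card_bwords_True_True of_nat_diff)
  also have "\<dots> = s ?m (int h)"
  proof (cases "?m > 0")
    case True
    have "(int L - 1) mod ?m = (int h + ?m) mod ?m" by simp
    also have "\<dots> = int h mod ?m" by (rule mod_add_self2)
    finally show ?thesis by (rule s_mod_eq[OF True])
  next
    \<comment> \<open>Either \<open>?m = 0\<close>, and then \<open>int L - 1 = int h\<close>, or
      \<open>?m = -1\<close>, where \<open>s\<close> vanishes.\<close>
    case False
    then show ?thesis using assms by (auto simp: s_def)
  qed
  finally show ?thesis .
qed

section \<open>Assembling the recurrence\<close>

lemma card_balanced_words:
  assumes "0 < L"
  shows "card (balanced_words L h) = card (bwords False False L h)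
    + 2 * card (bwords False True L h) + card (bwords True True L h)"
proof -
  have "balanced_words L h = (bwords False False L h \<union> bwords False True L h)
      \<union> (bwords True False L h \<union> bwords True True L h)" (is "_ = ?A \<union> ?B")
    using assms by (auto simp: bwords_def balanced_words_def)
  moreover have "card (?A \<union> ?B) = card ?A + card ?B"
    by (rule card_Un_disjoint) (auto simp: bwords_def)
  moreover have "card ?A = card (bwords False False L h) + card (bwords False True L h)"
    by (rule card_Un_disjoint) (auto simp: bwords_def)
  moreover have "card ?B = card (bwords True False L h) + card (bwords True True L h)"
    by (rule card_Un_disjoint) (auto simp: bwords_def)
  ultimately show ?thesis using card_bwords_rev[of True False L h] by simp
qed

lemma balanced_words_self: "balanced_words L L = {replicate L True}"
proof -
  have "w = replicate L True" if "length w = L" "height w = L" for w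
  proof -
    have "count_list w False = 0" using that by (simp add: count_list_False height_def)
    then have "\<forall>x \<in> set w. x = True" by (metis (full_types) count_list_0_iff)
    then show ?thesis using that(1) by (intro replicate_eqI) auto
  qed
  moreover have "balanced (replicate L True)"
    unfolding balanced_iff_steady steady_def by (simp add: ones_def count_list_eq_length_filter)
  moreover have "height (replicate L True) = L" by (simp add: height_def count_list_eq_length_filter)
  ultimately show ?thesis by (auto simp: balanced_words_def)
qed

lemma balanced_words_0: "balanced_words L 0 = {replicate L False}"
proof -
  have "w = replicate L False" if "length w = L" "height w = 0" for w
    using that by (intro replicate_eqI) (auto simp: height_def count_list_0_iff)
  moreover have "balanced (replicate L False)"
    unfolding balanced_iff_steady steady_def by (simp add: ones_def count_list_0_iff)
  ultimately show ?thesis by (auto simp: balanced_words_def height_def count_list_0_iff)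
qed

text \<open>For \<open>h = L\<close> the function \<open>s\<close> reduces the height to 0, but
  heights 0 and \<open>L\<close> each admit exactly one word. The recurrence meets this case at
  length \<open>L - h\<close> when \<open>L = 2 * h\<close>.\<close>

lemma s_eq_card:
  assumes "0 < L" "h \<le> L"
  shows "s (int L) (int h) = card (balanced_words L h)"
  using assms s_nat[of L h] by (cases "h = L") (auto simp: balanced_words_self balanced_words_0)

theorem theorem1:
  fixes L h :: nat
  assumes "2 * h \<le> L"
  shows "int (s (int L) (int h)) =
           int (s (int L - int h - 1) (int h))
         + int (s (int L - int h) (int h))
         - int (s (int L - 2 * int h - 1) (int h))
         + int (s (int h - 1) (int L - 2))
         + int (s (int h - 1) (int L - 1))"
proof (cases "L = 0")
  \<comment> \<open>The empty word has no end letters and escapes the count by ends.\<close>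
  case True
  then show ?thesis using assms by (simp add: s_def)
next
  case False
  let ?n = "\<lambda>c d L. card (bwords c d L h)"
  have "s (int L) (int h) = ?n False False L + 2 * ?n False True L + ?n True True L"
    using False assms by (simp add: s_eq_card card_balanced_words)
  moreover have "s (int L - int h) (int h)
      = ?n False False (L - h) + 2 * ?n False True (L - h) + ?n True True (L - h)"
    using False assms s_eq_card[of "L - h" h] by (simp add: card_balanced_words of_nat_diff)
  moreover have "?n False True L = ?n False True (L - h) + ?n True True (L - h)"
    by (rule card_bwords_False_True[OF assms])
  moreover have "?n False False L = s (int L - int h - 1) (int h)"
    using assms by (simp add: card_bwords_False_False)
  moreover have "?n False False (L - h) = s (int L - 2 * int h - 1) (int h)"
    using assms card_bwords_False_False[of h "L - h"] by (simp add: of_nat_diff algebra_simps)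
  moreover have "?n True True L = s (int h - 1) (int L - 1)"
    using assms by (simp add: card_bwords_True_True)
  moreover have "?n True True (L - h) = s (int h - 1) (int L - 2)"
  proof -
    have "?n True True (L - h) = s (int h - 1) (int L - int h - 1)"
      using assms card_bwords_True_True[of h "L - h"] by (simp add: of_nat_diff)
    also have "\<dots> = s (int h - 1) (int L - 2)"
    proof (cases "int h - 1 > 0")
      case True
      have "(int L - 2) mod (int h - 1) = (int L - int h - 1 + (int h - 1)) mod (int h - 1)"
        by (simp add: algebra_simps)
      also have "\<dots> = (int L - int h - 1) mod (int h - 1)" by (rule mod_add_self2)
      finally show ?thesis by (rule s_mod_eq[OF True, OF sym])
    next
      \<comment> \<open>For \<open>h = 1\<close> the second arguments coincide; for
        \<open>h = 0\<close> both values are 0.\<close>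
      case False
      then show ?thesis by (auto simp: s_def)
    qed
    finally show ?thesis .
  qed
  \<comment> \<open>Subtracting the two expansions, twice the difference of the
    \<open>?n False True\<close> terms is \<open>2 * ?n True True (L - h)\<close>, which leaves that
    term once with a plus sign.\<close>
  ultimately show ?thesis by linarith
qed

end
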